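(* Let $k\ge 3$ and $1\le d<k/2$ be integers. Then for integers $n$, \[ f_d^{n/k}(k,n) \le \left( g(k,d) + o(1) \right) \binom{n-d}{k-d}, \] where $o(1)$ denotes a function of $n$ (for fixed $k,d$) tending to $0$ as $n\to\infty$; equivalently, $c_{k,d}^*\le g(k,d)$, where $c_{k,d}^*:=\limsup_{n\to\infty} f_d^{n/k}(k,n)/\binom{n-d}{k-d}$ and \[ g(k,d) := 1- \left(1- \frac{(k-d)(k-2d-1)}{(k-1)^2} \right) \left( 1-\frac{1}{k} \right)^{k-d}. \]
   Context: A $k$-uniform hypergraph ($k$-graph) $H=(V,E)$ has finite vertex set $V$ and edge set $E$ a family of $k$-element subsets of $V$. For a $d$-set $S\subseteq V$, $\deg_H(S)$ is the number of edges containing $S$, and $\delta_d(H)=\min\{\deg_H(S): S\in\binom{V}{d}\}$. A fractional matching in $H$ is a function $w:E\to[0,1]$ such that $\sum_{e\in E: v\in e} w(e)\le 1$ for every $v\in V$; its size is $\sum_{e\in E}w(e)$, and it is perfect if its size is $|V|/k$. For a real $s$, $f_d^s(k,n)$ denotes the smallest integer $m$ such that every $n$-vertex $k$-graph $H$ with $\delta_d(H)\ge m$ has a fractional matching of size $s$. *)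

theory Defs
  imports Complex_Main
begin

definition kgraph :: "nat \<Rightarrow> 'a set \<Rightarrow> 'a set set \<Rightarrow> bool" where
  "kgraph k V E \<longleftrightarrow> finite V \<and> (\<forall>e\<in>E. e \<subseteq> V \<and> card e = k)"

definition hdeg :: "'a set set \<Rightarrow> 'a set \<Rightarrow> nat" where
  "hdeg E S = card {e \<in> E. S \<subseteq> e}"

definition min_codeg_ge :: "nat \<Rightarrow> 'a set \<Rightarrow> 'a set set \<Rightarrow> nat \<Rightarrow> bool" where
  "min_codeg_ge d V E m \<longleftrightarrow> (\<forall>S. S \<subseteq> V \<and> card S = d \<longrightarrow> hdeg E S \<ge> m)"

definition fractional_matching :: "'a set \<Rightarrow> 'a set set \<Rightarrow> ('a set \<Rightarrow> real) \<Rightarrow> bool" where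
  "fractional_matching V E w \<longleftrightarrow>
     (\<forall>e\<in>E. 0 \<le> w e \<and> w e \<le> 1) \<and> (\<forall>v\<in>V. (\<Sum>e\<in>{e\<in>E. v \<in> e}. w e) \<le> 1)"

definition has_frac_matching_of_size :: "'a set \<Rightarrow> 'a set set \<Rightarrow> real \<Rightarrow> bool" where
  "has_frac_matching_of_size V E s \<longleftrightarrow>
     (\<exists>w. fractional_matching V E w \<and> (\<Sum>e\<in>E. w e) = s)"

definition fdeg :: "nat \<Rightarrow> real \<Rightarrow> nat \<Rightarrow> nat \<Rightarrow> nat" where
  "fdeg d s k n = (LEAST m. \<forall>E. kgraph k {0..<n} E \<and> min_codeg_ge d {0..<n} E m
                     \<longrightarrow> has_frac_matching_of_size {0..<n} E s)"

definition gkd :: "nat \<Rightarrow> nat \<Rightarrow> real" where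
  "gkd k d = 1 - (1 - (real (k - d) * (real k - 2 * real d - 1)) / (real k - 1)^2)
                 * (1 - 1 / real k) ^ (k - d)"

end

theory Submission
  imports Defs "HOL-Combinatorics.Permutations"
begin

text \<open>If \<open>H\<close> has no perfect fractional matching, then by linear programming duality there are vertex
  weights for which every edge is heavier than \<open>k\<close> times the average weight. Let \<open>S\<close> consist of the
  \<open>d\<close> lightest vertices. After an affine change of weights, \<open>S\<close> has weight 0, the remaining
  weights are nonnegative with sum less than \<open>s\<close>, where \<open>s\<close> is about \<open>n / k\<close>, and the edges of the
  link of \<open>S\<close> are among the sets of \<open>l = k - d\<close> vertices of weight at least 1. These sets are counted
  along the lines of Frankl's proof of the Erdos matching bound. Let \<open>A\<close> be the \<open>s\<close> heaviest
  vertices, \<open>Y\<close> the remaining ones, and \<open>F(a)\<close> the family of \<open>(l-1)\<close>-subsets of \<open>Y\<close> that have weight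
  at least 1 together with \<open>a\<close>; let \<open>b\<close> be the lightest member of \<open>A\<close>. A shadow argument bounds the
  number of heavy \<open>l\<close>-subsets of \<open>Y\<close> by \<open>s |F(b)|\<close>. Averaging over random collections of \<open>h\<close> disjoint
  \<open>(l-1)\<close>-subsets of \<open>Y\<close>, where \<open>h\<close> is about \<open>s (k-1) / (l-1)\<close>, bounds
  \<open>\<Sum>a\<in>A. |F(a)| + (h - s) |F(b)|\<close> by \<open>s\<close> times the number of all \<open>(l-1)\<close>-subsets of \<open>Y\<close>. Frankl's
  bound corresponds to \<open>h \<ge> 2 s\<close>; for smaller \<open>h\<close> the excess \<open>(2 s - h) |F(b)|\<close>
  is what produces the correction term in \<open>gkd\<close>.\<close>

section \<open>Linear programming duality by elimination of one coordinate at a time\<close>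

lemma finite_separating_real:
  fixes A B :: "real set"
  assumes "finite A" "finite B" "\<And>a b. a \<in> A \<Longrightarrow> b \<in> B \<Longrightarrow> a < b"
  shows "\<exists>c. (\<forall>a\<in>A. a < c) \<and> (\<forall>b\<in>B. c < b)"
proof (cases "A = {} \<or> B = {}")
  case True
  then show ?thesis
  proof
    assume "A = {}"
    moreover have "\<forall>b\<in>B. Min (insert 0 B) - 1 < b"
      using assms(2) by (smt (verit) Min_le finite_insert insertI2)
    ultimately show ?thesis by blast
  next
    assume "B = {}"
    moreover have "\<forall>a\<in>A. a < Max (insert 0 A) + 1"
      using assms(1) by (smt (verit) Max_ge finite_insert insertI2)
    ultimately show ?thesis by blast
  qed
next
  case False
  then have "Max A < Min B" using assms by simp
  then obtain c where "Max A < c" "c < Min B" using dense by blast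
  then have "(\<forall>a\<in>A. a < c) \<and> (\<forall>b\<in>B. c < b)" using False assms by auto
  then show ?thesis ..
qed

text \<open>Gordan's alternative, by Fourier--Motzkin elimination of the coordinate \<open>z\<close>.\<close>
lemma gordan_alternative:
  fixes P :: "('v \<Rightarrow> real) set"
  assumes "finite V" "finite P"
  shows "(\<exists>a. \<forall>p\<in>P. 0 < (\<Sum>v\<in>V. a v * p v)) \<or>
         (\<exists>w. (\<forall>p\<in>P. 0 \<le> w p) \<and> 0 < (\<Sum>p\<in>P. w p) \<and> (\<forall>v\<in>V. (\<Sum>p\<in>P. w p * p v) = 0))"
  using assms
proof (induction V arbitrary: P rule: finite_induct)
  case empty
  show ?case
  proof (cases "P = {}")
    case False
    then have "0 < (\<Sum>p\<in>P. 1::real)" using empty by (simp add: card_gt_0_iff)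
    then show ?thesis by (intro disjI2 exI[of _ "\<lambda>_. 1"]) auto
  qed auto
next
  case (insert z V)
  define Pp where "Pp = {p\<in>P. p z > 0}"
  define Pm where "Pm = {p\<in>P. p z < 0}"
  \<comment> \<open>For \<open>p\<close> in \<open>Pp\<close> and \<open>g\<close> in
    \<open>Pm\<close> both multipliers \<open>p z\<close> and \<open>- g z\<close> are positive, so
    \<open>cmb (p, g)\<close> is a positive combination in which coordinate \<open>z\<close>
    cancels.\<close>
  define cmb where "cmb = (\<lambda>(p::'v \<Rightarrow> real, g::'v \<Rightarrow> real). \<lambda>u. p z * g u - g z * p u)"
  define Q where "Q = {p\<in>P. p z = 0} \<union> cmb ` (Pp \<times> Pm)"
  have fin: "finite Pp" "finite Pm" "finite Q"
    using insert.prems by (auto simp: Pp_def Pm_def Q_def)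
  have Qz: "q z = 0" if "q \<in> Q" for q
    using that by (auto simp: Q_def cmb_def)
  consider (dual) a where "\<forall>q\<in>Q. 0 < (\<Sum>v\<in>V. a v * q v)"
    | (primal) w where "\<forall>q\<in>Q. 0 \<le> w q" "0 < (\<Sum>q\<in>Q. w q)" "\<forall>v\<in>V. (\<Sum>q\<in>Q. w q * q v) = 0"
    using insert.IH[OF fin(3)] by blast
  then show ?case
  proof cases
    case dual
    define L where "L = (\<lambda>p. \<Sum>v\<in>V. a v * p v)"
    have Lc: "0 < p z * L g - g z * L p" if "p \<in> Pp" "g \<in> Pm" for p g
    proof -
      have "cmb (p, g) \<in> Q" using that by (auto simp: Q_def)
      then have "0 < (\<Sum>v\<in>V. a v * cmb (p, g) v)" using dual by blast
      also have "\<dots> = p z * L g - g z * L p"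
        unfolding L_def cmb_def by (simp add: sum_distrib_left sum_subtractf algebra_simps)
      finally show ?thesis .
    qed
    \<comment> \<open>The coefficient \<open>c\<close> of \<open>z\<close> must exceed a bound from
      each member of \<open>Pp\<close> and stay below one from each member of \<open>Pm\<close>.
      Positivity on the combinations \<open>cmb (p, g)\<close> says that every lower bound is below
      every upper bound.\<close>
    have "\<exists>c. (\<forall>x\<in>(\<lambda>p. - L p / p z) ` Pp. x < c) \<and> (\<forall>y\<in>(\<lambda>g. - L g / g z) ` Pm. c < y)"
    proof (rule finite_separating_real)
      fix x y assume "x \<in> (\<lambda>p. - L p / p z) ` Pp" "y \<in> (\<lambda>g. - L g / g z) ` Pm"
      then obtain p g where pg: "p \<in> Pp" "g \<in> Pm" "x = - L p / p z" "y = - L g / g z" by auto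
      then have "p z > 0" "g z < 0" by (auto simp: Pp_def Pm_def)
      have "- L p < L g * p z / (- g z)"
        using Lc[OF pg(1,2)] \<open>g z < 0\<close> by (subst pos_less_divide_eq) (auto simp: algebra_simps)
      then have "- L p < (L g / (- g z)) * p z" by simp
      then have "- L p / p z < L g / (- g z)"
        using \<open>p z > 0\<close> pos_divide_less_eq by blast
      then show "x < y" using pg(3,4) by simp
    qed (use fin in auto)
    then obtain c where c: "\<And>p. p \<in> Pp \<Longrightarrow> - L p / p z < c" "\<And>g. g \<in> Pm \<Longrightarrow> c < - L g / g z"
      by auto
    have "0 < (\<Sum>v\<in>insert z V. (a(z := c)) v * p v)" if "p \<in> P" for p
    proof -
      have "(\<Sum>v\<in>V. (a(z := c)) v * p v) = L p"
        unfolding L_def using insert.hyps by (intro sum.cong) auto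
      then have eq: "(\<Sum>v\<in>insert z V. (a(z := c)) v * p v) = c * p z + L p"
        using insert.hyps by simp
      consider "p z = 0" | "p z > 0" | "p z < 0" by linarith
      then have "0 < c * p z + L p"
      proof cases
        case 1
        then show ?thesis using that dual by (auto simp: Q_def L_def)
      next
        case 2
        then show ?thesis using c(1)[of p] that by (simp add: Pp_def field_simps)
      next
        case 3
        then show ?thesis using c(2)[of p] that by (simp add: Pm_def field_simps)
      qed
      then show ?thesis using eq by simp
    qed
    then show ?thesis by blast
  next
    case primal
    \<comment> \<open>Weights on \<open>Q\<close> pull back to \<open>P\<close>, since each member
      of \<open>Q\<close> is a nonnegative combination of members of \<open>P\<close>. Keeping the
      coefficient sum positive ensures that the weights pulled back do not all vanish.\<close>
    have "\<exists>c. (\<forall>p\<in>P. 0 \<le> c p) \<and> 0 < (\<Sum>p\<in>P. c p) \<and> (\<forall>u. q u = (\<Sum>p\<in>P. c p * p u))"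
      if "q \<in> Q" for q
      using that unfolding Q_def
    proof
      assume "q \<in> {p \<in> P. p z = 0}"
      then show ?thesis using insert.prems
        by (intro exI[of _ "\<lambda>p. if p = q then 1 else 0"])
          (auto simp: sum.delta if_distrib[of "\<lambda>t. t * _"] cong: if_cong)
    next
      assume "q \<in> cmb ` (Pp \<times> Pm)"
      then obtain p g where pg: "p \<in> P" "p z > 0" "g \<in> P" "g z < 0" "q = cmb (p, g)"
        by (auto simp: Pp_def Pm_def)
      let ?c = "\<lambda>f. (if f = g then p z else 0) + (if f = p then - g z else 0)"
      have "(\<Sum>f\<in>P. ?c f) = p z - g z"
        using pg insert.prems by (simp add: sum.distrib sum.delta)
      moreover have "(\<Sum>f\<in>P. ?c f * f u) = q u" for u
        using pg insert.prems
        by (simp add: sum.distrib sum.delta distrib_right cmb_def if_distrib[of "\<lambda>t. t * _"]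
            cong: if_cong)
      ultimately show ?thesis using pg by (intro exI[of _ ?c]) auto
    qed
    then obtain c where c: "\<And>q p. q \<in> Q \<Longrightarrow> p \<in> P \<Longrightarrow> 0 \<le> c q p"
      "\<And>q. q \<in> Q \<Longrightarrow> 0 < (\<Sum>p\<in>P. c q p)"
      "\<And>q u. q \<in> Q \<Longrightarrow> q u = (\<Sum>p\<in>P. c q p * p u)"
      by metis
    define w' where "w' = (\<lambda>p. \<Sum>q\<in>Q. w q * c q p)"
    have "0 \<le> w' p" if "p \<in> P" for p
      unfolding w'_def using primal(1) c(1) that by (intro sum_nonneg) auto
    moreover have "0 < (\<Sum>p\<in>P. w' p)"
    proof -
      have "(\<Sum>p\<in>P. w' p) = (\<Sum>q\<in>Q. w q * (\<Sum>p\<in>P. c q p))"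
        unfolding w'_def by (subst sum.swap) (simp add: sum_distrib_left)
      moreover obtain q0 where "q0 \<in> Q" "w q0 > 0"
        using primal(1,2) by (metis less_le not_less sum_nonpos)
      ultimately show ?thesis using c(2) primal(1) fin(3)
        by (smt (verit) mult_nonneg_nonneg mult_pos_pos sum_pos2)
    qed
    moreover have "(\<Sum>p\<in>P. w' p * p v) = 0" if "v \<in> insert z V" for v
    proof -
      have "(\<Sum>p\<in>P. w' p * p v) = (\<Sum>q\<in>Q. w q * (\<Sum>p\<in>P. c q p * p v))"
        unfolding w'_def sum_distrib_right
        by (subst sum.swap) (simp add: sum_distrib_left mult.assoc)
      also have "\<dots> = (\<Sum>q\<in>Q. w q * q v)" using c(3) by (intro sum.cong) auto
      also have "\<dots> = 0"
        using that primal(3) Qz by (cases "v = z") (auto intro!: sum.neutral)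
      finally show ?thesis .
    qed
    ultimately show ?thesis by blast
  qed
qed

section \<open>Lightest vertices, threshold families and their shadows\<close>

lemma ex_lowest_subset:
  fixes x :: "'a \<Rightarrow> real"
  assumes "finite V" "d \<le> card V"
  shows "\<exists>S\<subseteq>V. card S = d \<and> (\<forall>a\<in>S. \<forall>v\<in>V - S. x a \<le> x v)"
  using assms(2)
proof (induction d)
  case 0
  show ?case by (intro exI[of _ "{}"]) auto
next
  case (Suc d)
  then obtain S where S: "S \<subseteq> V" "card S = d" "\<forall>a\<in>S. \<forall>v\<in>V - S. x a \<le> x v" by auto
  then have "finite S" using assms(1) finite_subset by blast
  have "V - S \<noteq> {}" using S Suc.prems by auto
  then obtain m where "m \<in> V - S" "\<forall>v\<in>V - S. x m \<le> x v"
    by (metis arg_min_if_finite(1) arg_min_least assms(1) finite_Diff)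
  then show ?case using S \<open>finite S\<close> by (intro exI[of _ "insert m S"]) auto
qed

text \<open>The threshold \<open>t\<close> is a parameter because fixing a vertex \<open>z\<close>
  of the sets lowers it by \<open>x z\<close>; links of threshold families are then again of this
  form.\<close>

definition up :: "('a \<Rightarrow> real) \<Rightarrow> 'a set \<Rightarrow> nat \<Rightarrow> real \<Rightarrow> 'a set set" where
  "up x Y l t = {T. T \<subseteq> Y \<and> card T = l \<and> t \<le> sum x T}"

lemma finite_up [simp]: "finite Y \<Longrightarrow> finite (up x Y l t)"
  unfolding up_def by (rule finite_subset[of _ "Pow Y"]) auto

lemma card_up_insert:
  assumes "finite Y" "z \<notin> Y"
  shows "card (up x (insert z Y) (Suc l) t) = card (up x Y (Suc l) t) + card (up x Y l (t - x z))"
proof -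
  have fs: "finite T" if "T \<subseteq> Y" for T using that assms(1) finite_subset by blast
  have "up x (insert z Y) (Suc l) t = up x Y (Suc l) t \<union> insert z ` up x Y l (t - x z)"
    (is "?L = ?R")
  proof (intro equalityI subsetI)
    fix T assume T: "T \<in> ?L"
    show "T \<in> ?R"
    proof (cases "z \<in> T")
      case True
      have "finite T" using T assms(1) unfolding up_def by (auto intro: finite_subset)
      then have "T - {z} \<in> up x Y l (t - x z)" using T True
        by (auto simp: up_def sum_diff1)
      moreover have "T = insert z (T - {z})" using True by auto
      ultimately show ?thesis by blast
    next
      case False
      then show ?thesis using T by (auto simp: up_def)
    qed
  next
    fix T assume "T \<in> ?R"
    then show "T \<in> ?L"
    proof
      assume "T \<in> insert z ` up x Y l (t - x z)"
      then obtain U where U: "T = insert z U" "U \<in> up x Y l (t - x z)" by blast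
      moreover from U have "z \<notin> U" "finite U" using assms fs by (auto simp: up_def)
      ultimately show ?thesis by (auto simp: up_def)
    qed (auto simp: up_def)
  qed
  moreover have "up x Y (Suc l) t \<inter> insert z ` up x Y l (t - x z) = {}"
    using assms(2) by (auto simp: up_def)
  moreover have "inj_on (insert z) (up x Y l (t - x z))"
    using assms(2) by (intro inj_onI) (metis (mono_tags, lifting) insert_ident mem_Collect_eq subsetD up_def)
  ultimately show ?thesis using assms(1) by (simp add: card_Un_disjoint card_image)
qed

lemma up_antimono: "t' \<le> t \<Longrightarrow> up x Y l t \<subseteq> up x Y l t'"
  by (auto simp: up_def)

text \<open>Count pairs of a heavy set and one of its vertices. Removing the vertex costs at most
  \<open>b\<close>, and the smaller set together with the removed vertex determines the
  pair.\<close>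

lemma card_up_shadow_double_count:
  assumes "finite Y" "\<And>y. y \<in> Y \<Longrightarrow> x y \<le> b"
  shows "Suc r * card (up x Y (Suc r) t) \<le> (card Y - r) * card (up x Y r (t - b))"
proof -
  let ?A = "SIGMA T:up x Y (Suc r) t. T" and ?B = "SIGMA S:up x Y r (t - b). Y - S"
  have fs: "finite T" if "T \<subseteq> Y" for T using that assms(1) finite_subset by blast
  have "card ?A = (\<Sum>T\<in>up x Y (Suc r) t. card T)"
    using assms(1) fs by (subst card_SigmaI) (auto simp: up_def)
  also have "\<dots> = Suc r * card (up x Y (Suc r) t)" by (simp add: up_def)
  finally have A: "card ?A = Suc r * card (up x Y (Suc r) t)" .
  have "card ?B = (\<Sum>S\<in>up x Y r (t - b). card (Y - S))"
    using assms(1) by (subst card_SigmaI) auto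
  also have "\<dots> = (\<Sum>S\<in>up x Y r (t - b). card Y - r)"
    using fs by (intro sum.cong) (auto simp: up_def card_Diff_subset)
  finally have B: "card ?B = (card Y - r) * card (up x Y r (t - b))" by simp
  have "card ?A \<le> card ?B"
  proof (rule card_inj_on_le)
    show "inj_on (\<lambda>(T, y). (T - {y}, y)) ?A" by (auto simp: inj_on_def)
    show "(\<lambda>(T, y). (T - {y}, y)) ` ?A \<subseteq> ?B"
    proof clarsimp
      fix T y assume T: "T \<in> up x Y (Suc r) t" and y: "y \<in> T"
      have "finite T" using T fs by (auto simp: up_def)
      then show "T - {y} \<in> up x Y r (t - b) \<and> y \<in> Y"
        using T y assms(2)[of y] by (force simp: up_def sum_diff1)
    qed
    show "finite ?B" using assms(1) by auto
  qed
  then show ?thesis unfolding A B .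
qed

text \<open>A threshold version of Frankl's shadow bound; the hypothesis on \<open>U\<close> plays the role of
  having no \<open>s\<close> pairwise disjoint members, and is stable under deleting a lightest vertex.\<close>
lemma card_up_le_shadow:
  assumes "finite Y" "0 < s" "\<And>y. y \<in> Y \<Longrightarrow> x y \<le> b"
    and "\<And>U. U \<subseteq> Y \<Longrightarrow> card U = s * Suc r \<Longrightarrow> sum x U < real s * t"
  shows "card (up x Y (Suc r) t) \<le> (s - 1) * card (up x Y r (t - b))"
  using assms
proof (induction "card Y" arbitrary: Y r t)
  case 0
  then have "up x Y (Suc r) t = {}" by (auto simp: up_def)
  then show ?case by simp
next
  case (Suc n)
  show ?case
  proof (cases "card Y < s * Suc r")
    case True
    \<comment> \<open>Here no \<open>U\<close> of the required size exists, but \<open>Y\<close> is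
      so small that the double count alone gives the factor: \<open>card Y\<close> is at most
      \<open>s * Suc r - 1\<close>.\<close>
    then have "card Y - r \<le> (s - 1) * Suc r"
      using Suc.prems(2) by (cases s) auto
    then have "Suc r * card (up x Y (Suc r) t) \<le> ((s - 1) * Suc r) * card (up x Y r (t - b))"
      using card_up_shadow_double_count[OF Suc.prems(1,3)] by (meson le_trans mult_le_mono1)
    then have "Suc r * card (up x Y (Suc r) t) \<le> Suc r * ((s - 1) * card (up x Y r (t - b)))"
      by (simp only: ac_simps)
    then show ?thesis by (meson Suc_mult_le_cancel1)
  next
    case False
    show ?thesis
    proof (cases r)
      case 0
      \<comment> \<open>The family consists of singletons. Any \<open>s\<close> of them would form a
        forbidden \<open>U\<close>, and as soon as there is one, \<open>t \<le> b\<close>, so the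
        shadow family is \<open>{{}}\<close>.\<close>
      have eq: "up x Y (Suc r) t = (\<lambda>y. {y}) ` {y\<in>Y. t \<le> x y}"
        by (auto simp: up_def 0 card_Suc_eq)
      have "card {y\<in>Y. t \<le> x y} < s"
      proof (rule ccontr)
        assume "\<not> ?thesis"
        then obtain U where U: "U \<subseteq> {y\<in>Y. t \<le> x y}" "card U = s"
          by (meson not_less obtain_subset_with_card_n)
        then have "sum x U < real s * t" using 0 by (intro Suc.prems(4)) auto
        moreover have "real s * t \<le> sum x U" using U sum_bounded_below[of U t x] by auto
        ultimately show False by simp
      qed
      then have small: "card (up x Y (Suc r) t) \<le> s - 1"
        unfolding eq by (subst card_image) auto
      show ?thesis
      proof (cases "up x Y (Suc r) t = {}")
        case False
        then obtain y where "y \<in> Y" "t \<le> x y" unfolding eq by blast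
        then have "t \<le> b" using Suc.prems(3) by force
        then have "up x Y r (t - b) = {{}}"
          using Suc.prems(1) by (auto simp: up_def 0 dest: finite_subset)
        then show ?thesis using small by simp
      qed simp
    next
      case (Suc r')
      have "Y \<noteq> {}" using Suc.hyps(2) by auto
      then obtain z where z: "z \<in> Y" "\<And>y. y \<in> Y \<Longrightarrow> x z \<le> x y"
        by (metis arg_min_if_finite(1) arg_min_least Suc.prems(1))
      define Z where "Z = Y - {z}"
      have Z: "Y = insert z Z" "z \<notin> Z" "finite Z" "n = card Z"
        using z Suc.prems(1) Suc.hyps(2) by (auto simp: Z_def)
      have "card (up x Z (Suc r) t) \<le> (s - 1) * card (up x Z r (t - b))"
        using Suc.prems Z by (intro Suc.hyps(1)) auto
      moreover have "card (up x Z (Suc r') (t - x z)) \<le> (s - 1) * card (up x Z r' (t - x z - b))"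
      proof (intro Suc.hyps(1))
        \<comment> \<open>The sets through \<open>z\<close> have threshold \<open>t - x z\<close>.
          Since \<open>Y\<close> has at least \<open>s * Suc r\<close> vertices, \<open>U\<close>
          can be enlarged by \<open>s\<close> further ones, each at least as heavy as
          \<open>z\<close>; the hypothesis for the enlarged set gives the one needed for
          \<open>U\<close>.\<close>
        fix U assume U: "U \<subseteq> Z" "card U = s * Suc r'"
        have fU: "finite U" using U Z finite_subset by blast
        have "card (Y - U) = card Y - card U"
          using U Z fU by (intro card_Diff_subset) auto
        also have "\<dots> \<ge> s" using False U \<open>r = Suc r'\<close> by (simp add: algebra_simps)
        finally obtain W where W: "W \<subseteq> Y - U" "card W = s"
          by (meson obtain_subset_with_card_n)
        have fW: "finite W" using W Suc.prems(1) finite_subset by blast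
        have "sum x (U \<union> W) < real s * t"
        proof (rule Suc.prems(4))
          show "card (U \<union> W) = s * Suc r"
            using U W fU fW \<open>r = Suc r'\<close> by (subst card_Un_disjoint) auto
        qed (use U W Z in auto)
        moreover have "sum x (U \<union> W) = sum x U + sum x W"
          using W fU fW by (intro sum.union_disjoint) auto
        moreover have "real s * x z \<le> sum x W"
          using W sum_bounded_below[of W "x z" x] z(2) by auto
        ultimately show "sum x U < real s * (t - x z)" by (simp add: algebra_simps)
      qed (use Suc.prems Z in auto)
      moreover have "card (up x Y (Suc r) t) = card (up x Z (Suc r) t) + card (up x Z r (t - x z))"
        unfolding Z(1) using Z by (intro card_up_insert)
      moreover have "card (up x Y r (t - b)) = card (up x Z r (t - b)) + card (up x Z r' (t - x z - b))"
        unfolding Z(1) Suc using card_up_insert[OF Z(3,2), of x r' "t - b"]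
        by (simp add: algebra_simps)
      ultimately show ?thesis using \<open>r = Suc r'\<close> by (simp add: algebra_simps)
    qed
  qed
qed

section \<open>Averaging over random disjoint sets\<close>

lemma ex_permutes_image:
  assumes "finite Y" "T \<subseteq> Y" "T' \<subseteq> Y" "card T = card T'"
  shows "\<exists>\<sigma>. \<sigma> permutes Y \<and> \<sigma> ` T = T'"
proof -
  have fin: "finite T" "finite T'" using assms finite_subset by blast+
  obtain f where f: "bij_betw f T T'" using fin assms(4) finite_same_card_bij by blast
  have "card (Y - T) = card (Y - T')" using assms fin by (simp add: card_Diff_subset)
  then obtain g where g: "bij_betw g (Y - T) (Y - T')"
    using assms(1) finite_same_card_bij by (metis finite_Diff)
  define \<sigma> where "\<sigma> = (\<lambda>y. if y \<in> T then f y else if y \<in> Y then g y else y)"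
  have s1: "bij_betw \<sigma> T T'" using f by (subst bij_betw_cong[of _ _ f]) (auto simp: \<sigma>_def)
  moreover have "bij_betw \<sigma> (Y - T) (Y - T')"
    using g by (subst bij_betw_cong[of _ _ g]) (auto simp: \<sigma>_def)
  ultimately have "bij_betw \<sigma> (T \<union> (Y - T)) (T' \<union> (Y - T'))"
    by (rule bij_betw_combine) auto
  then have "bij_betw \<sigma> Y Y" using assms by (simp add: Un_absorb1)
  then have "\<sigma> permutes Y" using assms(2) by (intro bij_imp_permutes) (auto simp: \<sigma>_def)
  then show ?thesis using s1 by (auto simp: bij_betw_def)
qed

text \<open>Composing with a permutation that takes \<open>U\<close> to \<open>U'\<close> injects
  the permutations sending \<open>T\<close> to \<open>U\<close> into those sending \<open>T\<close>
  to \<open>U'\<close>. Hence all targets of the right size are hit equally often.\<close>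

lemma card_permutes_image_eq:
  assumes "finite Y" "T \<subseteq> Y" "T' \<subseteq> Y" "card T = card T'"
  shows "card {\<pi>. \<pi> permutes Y \<and> \<pi> ` T = T'} * (card Y choose card T) = fact (card Y)"
proof -
  define c where "c U = card {\<pi>. \<pi> permutes Y \<and> \<pi> ` T = U}" for U
  have fin: "finite {\<pi>. \<pi> permutes Y \<and> \<pi> ` T = U}" for U
    using finite_permutations[OF assms(1)] by (rule rev_finite_subset) auto
  have le: "c U \<le> c U'" if U: "U \<subseteq> Y" "U' \<subseteq> Y" "card U = card U'" for U U'
  proof -
    obtain \<sigma> where s: "\<sigma> permutes Y" "\<sigma> ` U = U'"
      using ex_permutes_image[OF assms(1) U] by blast
    show ?thesis unfolding c_def
    proof (rule card_inj_on_le[OF _ _ fin])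
      show "inj_on (\<lambda>\<pi>. \<sigma> \<circ> \<pi>) {\<pi>. \<pi> permutes Y \<and> \<pi> ` T = U}"
        using permutes_inj[OF s(1)] by (auto simp: inj_on_def fun_eq_iff dest: injD)
      show "(\<lambda>\<pi>. \<sigma> \<circ> \<pi>) ` {\<pi>. \<pi> permutes Y \<and> \<pi> ` T = U} \<subseteq> {\<pi>. \<pi> permutes Y \<and> \<pi> ` T = U'}"
        using s by (auto simp: permutes_compose image_comp[symmetric])
    qed
  qed
  let ?R = "{U. U \<subseteq> Y \<and> card U = card T}"
  have fR: "finite ?R" using assms(1) by simp
  have "{\<pi>. \<pi> permutes Y} = (\<Union>U\<in>?R. {\<pi>. \<pi> permutes Y \<and> \<pi> ` T = U})"
  proof -
    have "\<pi> ` T \<subseteq> Y \<and> card (\<pi> ` T) = card T" if "\<pi> permutes Y" for \<pi>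
      using that assms(2) by (metis card_image image_mono permutes_image permutes_inj_on)
    then show ?thesis by auto
  qed
  then have "fact (card Y) = card (\<Union>U\<in>?R. {\<pi>. \<pi> permutes Y \<and> \<pi> ` T = U})"
    using card_permutations[OF refl assms(1)] by simp
  also have "\<dots> = (\<Sum>U\<in>?R. c U)"
    unfolding c_def by (rule card_UN_disjoint) (use fR fin in auto)
  also have "\<dots> = (\<Sum>U\<in>?R. c T')"
    using le assms(3,4) by (intro sum.cong refl antisym) auto
  also have "\<dots> = c T' * (card Y choose card T)"
    using n_subsets[OF assms(1)] by simp
  finally show ?thesis by (simp add: c_def)
qed

text \<open>Averaging over all permutations of \<open>Y\<close>: a random permutation takes \<open>T j\<close> to a uniformly
  distributed \<open>r\<close>-subset.\<close>
lemma sum_card_le_of_permuted_hits: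
  fixes h :: nat
  assumes "finite Y" "\<And>j. j < h \<Longrightarrow> T j \<subseteq> Y" "\<And>j. j < h \<Longrightarrow> card (T j) = r"
    and "\<And>j. j < h \<Longrightarrow> F j \<subseteq> {U. U \<subseteq> Y \<and> card U = r}"
    and "\<And>\<pi>. \<pi> permutes Y \<Longrightarrow> card {j. j < h \<and> \<pi> ` T j \<in> F j} \<le> q"
  shows "(\<Sum>j<h. card (F j)) \<le> q * (card Y choose r)"
proof -
  let ?P = "{\<pi>. \<pi> permutes Y}" and ?b = "card Y choose r"
  have finP: "finite ?P" by (rule finite_permutations[OF assms(1)])
  have finF: "finite (F j)" if "j < h" for j
    using assms(1) assms(4)[OF that] by (intro finite_subset[of "F j" "Pow Y"]) auto
  \<comment> \<open>This is the hitting probability, \<open>card (F j)\<close> over the number of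
    \<open>r\<close>-subsets, with denominators cleared.\<close>
  have hit: "card {\<pi>\<in>?P. \<pi> ` T j \<in> F j} * ?b = card (F j) * fact (card Y)" if j: "j < h" for j
  proof -
    have "{\<pi>\<in>?P. \<pi> ` T j \<in> F j} = (\<Union>U\<in>F j. {\<pi>. \<pi> permutes Y \<and> \<pi> ` T j = U})" by auto
    then have "card {\<pi>\<in>?P. \<pi> ` T j \<in> F j} = (\<Sum>U\<in>F j. card {\<pi>. \<pi> permutes Y \<and> \<pi> ` T j = U})"
      using finF[OF j] finP by (simp only:) (rule card_UN_disjoint; auto)
    then have "card {\<pi>\<in>?P. \<pi> ` T j \<in> F j} * ?b
        = (\<Sum>U\<in>F j. card {\<pi>. \<pi> permutes Y \<and> \<pi> ` T j = U} * ?b)"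
      by (simp add: sum_distrib_right)
    also have "\<dots> = (\<Sum>U\<in>F j. fact (card Y))"
    proof (rule sum.cong[OF refl])
      fix U assume "U \<in> F j"
      then show "card {\<pi>. \<pi> permutes Y \<and> \<pi> ` T j = U} * ?b = fact (card Y)"
        using card_permutes_image_eq[OF assms(1) assms(2)[OF j], of U] assms(3,4)[OF j] by auto
    qed
    finally show ?thesis by simp
  qed
  have "fact (card Y) * (\<Sum>j<h. card (F j)) = (\<Sum>j<h. card {\<pi>\<in>?P. \<pi> ` T j \<in> F j}) * ?b"
    unfolding sum_distrib_right sum_distrib_left using hit
    by (intro sum.cong) (simp_all only: lessThan_iff mult.commute)
  also have "(\<Sum>j<h. card {\<pi>\<in>?P. \<pi> ` T j \<in> F j}) = (\<Sum>\<pi>\<in>?P. card {j\<in>{..<h}. \<pi> ` T j \<in> F j})"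
    by (rule sum_multicount_gen) (use finP in auto)
  also have "\<dots> \<le> (\<Sum>\<pi>\<in>?P. q)"
    using assms(5) by (intro sum_mono) auto
  also have "\<dots> = fact (card Y) * q"
    using card_permutations[OF refl assms(1)] by simp
  finally have "fact (card Y) * (\<Sum>j<h. card (F j)) \<le> fact (card Y) * (q * ?b)"
    by (simp add: mult.assoc mult_right_mono)
  then show ?thesis by simp
qed

lemma ex_disjoint_blocks:
  assumes "finite Y" "h * r \<le> card Y"
  shows "\<exists>T. (\<forall>j<h. T j \<subseteq> Y \<and> card (T j) = r) \<and> (\<forall>i<h. \<forall>j<h. i \<noteq> j \<longrightarrow> T i \<inter> T j = {})"
  using assms(2)
proof (induction h)
  case (Suc h)
  then obtain T where T: "\<forall>j<h. T j \<subseteq> Y \<and> card (T j) = r"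
    "\<forall>i<h. \<forall>j<h. i \<noteq> j \<longrightarrow> T i \<inter> T j = {}" by auto
  have "card (\<Union>j<h. T j) \<le> (\<Sum>j<h. card (T j))" by (rule card_UN_le) simp
  also have "\<dots> = h * r" using T by simp
  finally have "r \<le> card Y - card (\<Union>j<h. T j)" using Suc.prems by simp
  also have "\<dots> \<le> card (Y - (\<Union>j<h. T j))" by (rule diff_card_le_card_Diff)
      (use T assms(1) in \<open>auto intro: finite_subset\<close>)
  finally obtain U where U: "U \<subseteq> Y - (\<Union>j<h. T j)" "card U = r"
    by (meson obtain_subset_with_card_n)
  have "\<forall>i<Suc h. \<forall>j<Suc h. i \<noteq> j \<longrightarrow> (T(h := U)) i \<inter> (T(h := U)) j = {}"
    using T(2) U(1) by (auto simp: less_Suc_eq)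
  moreover have "\<forall>j<Suc h. (T(h := U)) j \<subseteq> Y \<and> card ((T(h := U)) j) = r"
    using T(1) U by (auto simp: less_Suc_eq)
  ultimately show ?case by blast
qed auto

text \<open>Match the members of \<open>A\<close>, followed by \<open>h - s\<close> copies of a lower bound \<open>b\<close> of their weights,
  with \<open>h\<close> random disjoint \<open>r\<close>-sets. If \<open>s\<close> of the pairs had weight at least 1, then replacing the
  copies of \<open>b\<close> among them by unused members of \<open>A\<close> would give total weight at least \<open>s\<close>.\<close>
lemma sum_card_up_le:
  fixes x :: "'a \<Rightarrow> real"
  assumes "finite A" "finite Y" "A \<inter> Y = {}" "\<And>v. v \<in> A \<union> Y \<Longrightarrow> 0 \<le> x v"
    and "sum x (A \<union> Y) < real s" "card A = s" "s \<le> h" "h * r \<le> card Y"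
    and "\<And>a. a \<in> A \<Longrightarrow> b \<le> x a"
  shows "(\<Sum>a\<in>A. card (up x Y r (1 - x a))) + (h - s) * card (up x Y r (1 - b))
    \<le> (s - 1) * (card Y choose r)"
proof -
  obtain f where f: "bij_betw f {..<s} A"
    using assms(1,6) by (metis card_lessThan finite_lessThan finite_same_card_bij)
  obtain T where T: "\<And>j. j < h \<Longrightarrow> T j \<subseteq> Y" "\<And>j. j < h \<Longrightarrow> card (T j) = r"
    "\<And>i j. i < h \<Longrightarrow> j < h \<Longrightarrow> i \<noteq> j \<Longrightarrow> T i \<inter> T j = {}"
    using ex_disjoint_blocks[OF assms(2,8)] by metis
  define c where "c j = (if j < s then x (f j) else b)" for j
  define F where "F j = up x Y r (1 - c j)" for j
  have "(\<Sum>j<h. card (F j)) \<le> (s - 1) * (card Y choose r)"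
  proof (rule sum_card_le_of_permuted_hits[OF assms(2) T(1,2)])
    show "F j \<subseteq> {U. U \<subseteq> Y \<and> card U = r}" for j by (auto simp: F_def up_def)
    fix \<pi> assume \<pi>: "\<pi> permutes Y"
    let ?J = "{j. j < h \<and> \<pi> ` T j \<in> F j}"
    have "card ?J < s"
    proof (rule ccontr)
      assume "\<not> ?thesis"
      then obtain J where J: "J \<subseteq> ?J" "card J = s"
        by (meson not_less obtain_subset_with_card_n)
      have finJ: "finite J" using J(1) by (rule finite_subset) auto
      have "real s \<le> (\<Sum>j\<in>J. c j + sum x (\<pi> ` T j))"
        using J sum_bounded_below[of J 1 "\<lambda>j. c j + sum x (\<pi> ` T j)"]
        by (force simp: F_def up_def)
      also have "\<dots> = sum c J + (\<Sum>j\<in>J. sum x (\<pi> ` T j))" by (rule sum.distrib)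
      finally have "real s \<le> sum c J + (\<Sum>j\<in>J. sum x (\<pi> ` T j))" .
      moreover have "(\<Sum>j\<in>J. sum x (\<pi> ` T j)) = sum x (\<Union>j\<in>J. \<pi> ` T j)"
      proof (rule sum.UNION_disjoint[symmetric, OF finJ])
        show "\<forall>j\<in>J. finite (\<pi> ` T j)"
        proof
          fix j assume "j \<in> J"
          then have "T j \<subseteq> Y" using J(1) by (intro T(1)) auto
          then show "finite (\<pi> ` T j)" using assms(2) finite_subset by auto
        qed
        show "\<forall>i\<in>J. \<forall>j\<in>J. i \<noteq> j \<longrightarrow> \<pi> ` T i \<inter> \<pi> ` T j = {}"
        proof (intro ballI impI)
          fix i j assume "i \<in> J" "j \<in> J" "i \<noteq> j"
          then have "T i \<inter> T j = {}" using J(1) by (intro T(3)) auto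
          then show "\<pi> ` T i \<inter> \<pi> ` T j = {}"
            using image_Int[OF permutes_inj[OF \<pi>], of "T i" "T j"] by simp
        qed
      qed
      moreover have "sum x (\<Union>j\<in>J. \<pi> ` T j) \<le> sum x Y"
      proof (rule sum_mono2[OF assms(2)])
        have "\<pi> ` T j \<subseteq> Y" if "j \<in> J" for j
        proof -
          have "T j \<subseteq> Y" using J(1) that by (intro T(1)) auto
          then show ?thesis using permutes_image[OF \<pi>] by blast
        qed
        then show "(\<Union>j\<in>J. \<pi> ` T j) \<subseteq> Y" by blast
      qed (use assms(4) in blast)
      moreover have "sum c J \<le> sum x A"
      proof -
        have "card (J - {..<s}) = card ({..<s} - J)"
          using card_Diff_subset_Int[of J "{..<s}"] card_Diff_subset_Int[of "{..<s}" J] J(2) finJ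
          by (simp add: Int_commute)
        moreover have "sum c (J - {..<s}) = real (card (J - {..<s})) * b"
          by (simp add: c_def)
        moreover have "real (card ({..<s} - J)) * b \<le> sum c ({..<s} - J)"
          using assms(9) f sum_bounded_below[of "{..<s} - J" b c]
          by (auto simp: c_def bij_betw_def)
        ultimately have "sum c (J - {..<s}) \<le> sum c ({..<s} - J)" by simp
        moreover have "sum c J = sum c (J \<inter> {..<s}) + sum c (J - {..<s})"
          using finJ by (rule sum.Int_Diff)
        moreover have "sum c {..<s} = sum c ({..<s} \<inter> J) + sum c ({..<s} - J)"
          by (rule sum.Int_Diff) simp
        moreover have "sum c {..<s} = sum x A"
          using sum.reindex_bij_betw[OF f, of x] by (simp add: c_def)
        ultimately show ?thesis by (simp add: Int_commute)
      qed
      moreover have "sum x (A \<union> Y) = sum x A + sum x Y"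
        using assms(1-3) by (rule sum.union_disjoint)
      ultimately show False using assms(5) by simp
    qed
    then show "card ?J \<le> s - 1" by simp
  qed auto
  moreover have "(\<Sum>j<h. card (F j)) = (\<Sum>j<s. card (F j)) + (\<Sum>j=s..<h. card (F j))"
    using assms(7) by (metis lessThan_atLeast0 sum.atLeastLessThan_concat zero_le)
  moreover have "(\<Sum>j<s. card (F j)) = (\<Sum>a\<in>A. card (up x Y r (1 - x a)))"
    using sum.reindex_bij_betw[OF f, of "\<lambda>a. card (up x Y r (1 - x a))"]
    by (simp add: F_def c_def)
  moreover have "(\<Sum>j=s..<h. card (F j)) = (h - s) * card (up x Y r (1 - b))"
    by (simp add: F_def c_def)
  ultimately show ?thesis by simp
qed

section \<open>Counting the heavy sets in a link\<close>

text \<open>Sets with at least two vertices in \<open>A\<close> are all counted as heavy; only those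
  with none or exactly one are tested by weight. The binomials on the left remove the latter two
  kinds from the count of all sets, and stand there to avoid subtraction of naturals.\<close>

lemma card_up_Un_le:
  assumes "finite A" "finite Y" "A \<inter> Y = {}"
  shows "card (up x (A \<union> Y) (Suc r) t) + (card Y choose Suc r) + card A * (card Y choose r)
    \<le> (card (A \<union> Y) choose Suc r) + card (up x Y (Suc r) t) + (\<Sum>a\<in>A. card (up x Y r (t - x a)))"
  using assms(1,3)
proof (induction A rule: finite_induct)
  case (insert a A)
  let ?Z = "A \<union> Y"
  have Z: "finite ?Z" "a \<notin> ?Z" using insert assms(2) by auto
  \<comment> \<open>Inclusion-exclusion: inside the \<open>r\<close>-subsets of \<open>?Z\<close>,
    the heavy ones and the subsets of \<open>Y\<close> overlap exactly in the heavy subsets of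
    \<open>Y\<close>.\<close>
  have "card (up x ?Z r (t - x a)) + (card Y choose r)
      \<le> (card ?Z choose r) + card (up x Y r (t - x a))"
  proof -
    let ?P = "\<lambda>Z. {U. U \<subseteq> Z \<and> card U = r}"
    have "up x ?Z r (t - x a) \<union> ?P Y \<subseteq> ?P ?Z" "up x ?Z r (t - x a) \<inter> ?P Y = up x Y r (t - x a)"
      by (auto simp: up_def)
    moreover have "card (up x ?Z r (t - x a)) + card (?P Y)
        = card (up x ?Z r (t - x a) \<union> ?P Y) + card (up x ?Z r (t - x a) \<inter> ?P Y)"
      using Z(1) assms(2) by (intro card_Un_Int) auto
    moreover have "card (up x ?Z r (t - x a) \<union> ?P Y) \<le> card (?P ?Z)"
      using Z(1) calculation(1) by (intro card_mono) auto
    ultimately show ?thesis using n_subsets[OF Z(1)] n_subsets[OF assms(2)] by simp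
  qed
  moreover have "card (up x (insert a A \<union> Y) (Suc r) t)
      = card (up x ?Z (Suc r) t) + card (up x ?Z r (t - x a))"
    using card_up_insert[OF Z] by simp
  moreover have "card (insert a A \<union> Y) choose Suc r = (card ?Z choose r) + (card ?Z choose Suc r)"
    using Z by simp
  ultimately show ?case using insert by simp
qed simp

text \<open>Here \<open>m\<close> is the number of vertices outside a \<open>d\<close>-set, \<open>s\<close> is slightly above \<open>n / k\<close>, and \<open>h\<close> is
  the number of disjoint \<open>r\<close>-sets available outside the \<open>s\<close> heaviest vertices.\<close>
definition link_bound :: "nat \<Rightarrow> nat \<Rightarrow> nat \<Rightarrow> nat \<Rightarrow> real" where
  "link_bound m s h r = real (m choose Suc r) - real ((m - s) choose Suc r)
     + max 0 (2 * real s - real h) * (real s * real ((m - s) choose r) / real h)"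

lemma link_bound_nonneg: "0 \<le> link_bound m s h r"
  using binomial_right_mono[of "m - s" m "Suc r"] by (simp add: link_bound_def)

text \<open>Heavy sets inside \<open>Y\<close> number at most \<open>s * q\<close> by the shadow
  bound, those with one vertex in \<open>A\<close> at most \<open>s * K - (h - s) * q\<close> by
  averaging. Adding all sets with two or more vertices in \<open>A\<close> leaves the excess
  \<open>(2 * s - h) * q\<close>.\<close>

lemma card_up_le_link_bound:
  fixes x :: "'a \<Rightarrow> real"
  assumes "finite M" "\<And>v. v \<in> M \<Longrightarrow> 0 \<le> x v" "sum x M < real s" "s \<le> card M" "s \<le> h"
    and "h * r \<le> card M - s"
  shows "real (card (up x M (Suc r) 1)) \<le> link_bound (card M) s h r"
proof -
  have "0 \<le> sum x M" using assms(2) by (rule sum_nonneg)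
  then have s: "0 < s" using assms(3) by linarith
  obtain A where A: "A \<subseteq> M" "card A = s" "\<And>a y. a \<in> A \<Longrightarrow> y \<in> M - A \<Longrightarrow> x y \<le> x a"
    using ex_lowest_subset[OF assms(1,4), of "\<lambda>v. - x v"] by auto
  define Y where "Y = M - A"
  have finA: "finite A" using A(1) assms(1) finite_subset by blast
  have Y: "finite Y" "A \<inter> Y = {}" "A \<union> Y = M" "card Y = card M - s"
    using A finA assms(1) by (auto simp: Y_def card_Diff_subset)
  define b where "b = Min (x ` A)"
  have "A \<noteq> {}" using A s by auto
  then have "b \<in> x ` A" unfolding b_def using finA by (intro Min_in) auto
  then have Yb: "x y \<le> b" if "y \<in> Y" for y using A(3) that by (auto simp: Y_def)
  have Ab: "b \<le> x a" if "a \<in> A" for a unfolding b_def using that finA by simp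
  define q where "q = card (up x Y r (1 - b))"
  define K where "K = (card Y choose r)"
  define D where "D = (\<Sum>a\<in>A. card (up x Y r (1 - x a)))"
  have "card (up x Y (Suc r) 1) \<le> (s - 1) * q"
    unfolding q_def
  proof (rule card_up_le_shadow[OF Y(1) s Yb])
    fix U assume "U \<subseteq> Y"
    then have "sum x U \<le> sum x M" using Y assms(1,2) by (intro sum_mono2) auto
    then show "sum x U < real s * 1" using assms(3) by simp
  qed
  then have shadow: "card (up x Y (Suc r) 1) \<le> s * q"
    by (meson diff_le_self le_trans mult_le_mono1)
  have "D + (h - s) * q \<le> (s - 1) * K"
    unfolding D_def q_def K_def
    by (rule sum_card_up_le) (use finA Y A assms Ab in auto)
  then have avg: "D + (h - s) * q \<le> s * K"
    by (meson diff_le_self le_trans mult_le_mono1)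
  \<comment> \<open>Every member of \<open>A\<close> is at least as heavy as \<open>b\<close>, so
    each summand of \<open>D\<close> is at least \<open>q\<close>. With the averaging bound this
    gives \<open>h * q \<le> s * K\<close>.\<close>
  have "card A * q \<le> D"
    unfolding D_def q_def using Ab Y(1)
    by (intro sum_bounded_below[where 'a = nat, simplified] card_mono up_antimono) auto
  then have "h * q \<le> s * K"
    using avg A(2) assms(5) by (simp add: diff_mult_distrib)
  then have hq: "real h * real q \<le> real s * real K" by (metis of_nat_le_iff of_nat_mult)
  have h: "0 < real h" using s assms(5) by simp
  have q: "real q \<le> real s * real K / real h" using hq h by (simp add: field_simps)
  have "real (card (up x M (Suc r) 1)) + real (card Y choose Suc r) + real s * real K
      \<le> real (card M choose Suc r) + real (card (up x Y (Suc r) 1)) + real D"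
    using card_up_Un_le[OF finA Y(1,2), of x r 1] A(2)
    unfolding Y(3) K_def[symmetric] D_def[symmetric]
    by (metis (mono_tags, lifting) of_nat_add of_nat_le_iff of_nat_mult)
  moreover have "real (card (up x Y (Suc r) 1)) \<le> real s * real q"
    using shadow by (metis of_nat_le_iff of_nat_mult)
  moreover have "real D + (real h - real s) * real q \<le> real s * real K"
    using avg assms(5) by (metis of_nat_add of_nat_diff of_nat_le_iff of_nat_mult)
  ultimately have "real (card (up x M (Suc r) 1))
      \<le> real (card M choose Suc r) - real (card Y choose Suc r) + (2 * real s - real h) * real q"
    by (simp add: algebra_simps)
  \<comment> \<open>The upper bound on \<open>q\<close> helps only if its coefficient is
    nonnegative; otherwise the term is dropped.\<close>
  also have "(2 * real s - real h) * real q \<le> max 0 (2 * real s - real h) * real q"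
    by (intro mult_right_mono) auto
  also have "\<dots> \<le> max 0 (2 * real s - real h) * (real s * real K / real h)"
    using q by (intro mult_left_mono) auto
  finally show ?thesis by (simp add: link_bound_def K_def Y(4))
qed

section \<open>From a missing perfect fractional matching to a set of low degree\<close>

text \<open>Gordan's alternative for the vectors \<open>1\<^sub>e - k / |V|\<close>; the weights \<open>a\<close> may be negative.\<close>
lemma separating_weights:
  assumes "kgraph k V E" "0 < k" "V \<noteq> {}"
    and "\<not> has_frac_matching_of_size V E (real (card V) / real k)"
  shows "\<exists>a. \<forall>e\<in>E. real k / real (card V) * sum a V < sum a e"
proof -
  have V: "finite V" and E: "\<And>e. e \<in> E \<Longrightarrow> e \<subseteq> V \<and> card e = k"
    using assms(1) by (auto simp: kgraph_def)
  have finE: "finite E" using V E by (meson PowI finite_Pow_iff finite_subset subsetI)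
  define n where "n = real (card V)"
  have n: "n > 0" using V assms(3) by (simp add: n_def card_gt_0_iff)
  define p where "p e v = (if v \<in> e then 1 else 0) - real k / n" for e :: "'a set" and v
  have inj: "inj_on p E"
  proof (rule inj_onI)
    fix e f assume eq: "p e = p f"
    have "v \<in> e \<longleftrightarrow> v \<in> f" for v
      using fun_cong[OF eq, of v] by (simp add: p_def split: if_splits)
    then show "e = f" by blast
  qed
  have dot: "(\<Sum>v\<in>V. a v * p e v) = sum a e - real k / n * sum a V" if "e \<in> E" for a e
  proof -
    have "(\<Sum>v\<in>V. a v * (if v \<in> e then 1 else 0)) = sum a e"
      using V E[OF that] by (simp add: sum.If_cases if_distrib Int_absorb1 cong: if_cong)
    then show ?thesis
      by (simp add: p_def right_diff_distrib sum_subtractf sum_distrib_left sum_divide_distrib mult.commute)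
  qed
  consider a where "\<forall>q\<in>p ` E. 0 < (\<Sum>v\<in>V. a v * q v)"
    | w where "\<forall>q\<in>p ` E. 0 \<le> w q" "0 < sum w (p ` E)" "\<forall>v\<in>V. (\<Sum>q\<in>p ` E. w q * q v) = 0"
    using gordan_alternative[OF V finite_imageI[OF finE, of p]] by blast
  then show ?thesis
  proof cases
    case 1
    then show ?thesis using dot by (intro exI[of _ a]) (auto simp: n_def)
  next
    case 2
    define W where "W = (\<Sum>e\<in>E. w (p e))"
    have W: "W > 0" using 2(2) inj by (simp add: W_def sum.reindex)
    \<comment> \<open>Orthogonality makes the degree of \<open>w\<close> equal to
      \<open>k * W / n\<close> at every vertex, so this scaling makes all degrees 1.\<close>
    define u where "u e = n / (real k * W) * w (p e)" for e
    have u0: "0 \<le> u e" if "e \<in> E" for e using that 2(1) W n by (simp add: u_def)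
    have deg: "(\<Sum>e\<in>{e\<in>E. v \<in> e}. u e) = 1" if "v \<in> V" for v
    proof -
      have "0 = (\<Sum>e\<in>E. w (p e) * p e v)"
        using 2(3) that inj by (simp add: sum.reindex)
      also have "\<dots> = (\<Sum>e\<in>E. w (p e) * (if v \<in> e then 1 else 0)) - real k / n * W"
        by (simp add: p_def right_diff_distrib sum_subtractf sum_distrib_left W_def mult.commute)
      also have "(\<Sum>e\<in>E. w (p e) * (if v \<in> e then 1 else 0)) = (\<Sum>e\<in>{e\<in>E. v \<in> e}. w (p e))"
        using finE by (simp add: if_distrib sum.inter_filter cong: if_cong)
      finally have "(\<Sum>e\<in>{e\<in>E. v \<in> e}. w (p e)) = real k / n * W" by simp
      moreover have "(\<Sum>e\<in>{e\<in>E. v \<in> e}. u e) = n / (real k * W) * (\<Sum>e\<in>{e\<in>E. v \<in> e}. w (p e))"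
        unfolding u_def by (rule sum_distrib_left[symmetric])
      ultimately show ?thesis using W n assms(2) by simp
    qed
    have "u e \<le> 1" if e: "e \<in> E" for e
    proof -
      have "e \<noteq> {}" using E[OF e] assms(2) by (metis card.empty less_irrefl)
      then obtain v where v: "v \<in> e" "v \<in> V" using E[OF e] by blast
      then have "u e \<le> (\<Sum>e\<in>{e\<in>E. v \<in> e}. u e)"
        using e finE u0 by (intro member_le_sum) auto
      then show ?thesis using deg v by simp
    qed
    then have "fractional_matching V E u"
      using u0 deg by (auto simp: fractional_matching_def)
    moreover have "sum u E = n / (real k * W) * W"
      unfolding u_def W_def by (rule sum_distrib_left[symmetric])
    then have "sum u E = real (card V) / real k" using W by (simp add: n_def)
    ultimately show ?thesis using assms(4) by (auto simp: has_frac_matching_of_size_def)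
  qed
qed

text \<open>For the \<open>d\<close> lightest vertices \<open>S\<close>, shifted to total weight 0,
  an edge through \<open>S\<close> leaves weight above \<tau> outside \<open>S\<close>. Dividing by
  \<tau> turns the threshold into 1 and the total weight into \<open>n / k\<close>, which is less
  than \<open>s\<close>.\<close>

lemma ex_low_degree_set:
  assumes "kgraph k V E" "0 < d" "k = d + Suc r" "card V = n"
    and "\<not> has_frac_matching_of_size V E (real n / real k)"
    and "n < s * k" "d + s \<le> n" "s \<le> h" "h * r \<le> n - d - s"
  shows "\<exists>S\<subseteq>V. card S = d \<and> real (hdeg E S) \<le> link_bound (n - d) s h r"
proof -
  have V: "finite V" and E: "\<And>e. e \<in> E \<Longrightarrow> e \<subseteq> V \<and> card e = k"
    using assms(1) by (auto simp: kgraph_def)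
  have n: "0 < n" "V \<noteq> {}" using assms(2,4,7) by auto
  have k: "0 < k" using assms(3) by simp
  obtain a where a: "\<And>e. e \<in> E \<Longrightarrow> real k / real n * sum a V < sum a e"
    using separating_weights[OF assms(1) k n(2)] assms(4,5) by auto
  obtain S where S: "S \<subseteq> V" "card S = d" "\<And>u v. u \<in> S \<Longrightarrow> v \<in> V - S \<Longrightarrow> a u \<le> a v"
    using ex_lowest_subset[OF V, of d a] assms(4,7) by auto
  have finS: "finite S" using S(1) V finite_subset by blast
  \<comment> \<open>Shifting all weights by the mean over \<open>S\<close> keeps the separation, because every edge has \<open>k\<close>
    vertices, and makes \<open>S\<close> weightless and the other weights nonnegative.\<close>
  define \<mu> where "\<mu> = sum a S / real d"
  define u where "u v = a v - \<mu>" for v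
  define \<tau> where "\<tau> = real k / real n * sum u V"
  define M where "M = V - S"
  have M: "finite M" "card M = n - d"
    using V S finS assms(4) by (auto simp: M_def card_Diff_subset)
  have sumS: "sum u S = 0" using S(2) assms(2) by (simp add: u_def sum_subtractf \<mu>_def)
  have u0: "0 \<le> u v" if "v \<in> M" for v
    using sum_bounded_above[of S a "a v"] S(2,3) that assms(2)
    by (simp add: u_def \<mu>_def M_def field_simps)
  have VM: "sum u V = sum u M"
    using sum.subset_diff[OF S(1) V, of u] sumS by (simp add: M_def)
  have eT: "\<tau> < sum u (e - S)" if "e \<in> E" "S \<subseteq> e" for e
  proof -
    have "finite e" using E[OF that(1)] V finite_subset by blast
    then have "sum u e = sum u (e - S)"
      using sum.subset_diff[OF that(2), of u] sumS by simp
    moreover have "sum u e = sum a e - real k * \<mu>"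
      using E[OF that(1)] by (simp add: u_def sum_subtractf)
    moreover have "\<tau> = real k / real n * sum a V - real k * \<mu>"
      using n assms(4) by (simp add: \<tau>_def u_def sum_subtractf field_simps)
    ultimately show ?thesis using a[OF that(1)] by simp
  qed
  have up0: "0 \<le> sum u M" using u0 by (rule sum_nonneg)
  have "real (hdeg E S) \<le> link_bound (n - d) s h r"
  \<comment> \<open>If \<tau> vanishes, normalising is impossible, but then the total weight is 0
    and no edge contains \<open>S\<close>.\<close>
  proof (cases "\<tau> = 0")
    case True
    have "e \<notin> E" if "S \<subseteq> e" for e
    proof
      assume e: "e \<in> E"
      have "sum u (e - S) \<le> sum u M"
        using E[OF e] M u0 by (intro sum_mono2) (auto simp: M_def)
      then show False using eT[OF e that] True VM n k by (simp add: \<tau>_def)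
    qed
    then have "{e\<in>E. S \<subseteq> e} = {}" by blast
    then show ?thesis using link_bound_nonneg[of "n - d" s h r]
      by (simp only: hdeg_def card.empty of_nat_0)
  next
    case False
    moreover have "0 \<le> \<tau>" unfolding \<tau>_def VM using up0 by simp
    ultimately have \<tau>: "\<tau> > 0" by linarith
    define x where "x v = u v / \<tau>" for v
    have "hdeg E S \<le> card (up x M (Suc r) 1)"
      unfolding hdeg_def
    proof (rule card_inj_on_le)
      show "inj_on (\<lambda>e. e - S) {e\<in>E. S \<subseteq> e}" by (auto simp: inj_on_def)
      show "(\<lambda>e. e - S) ` {e\<in>E. S \<subseteq> e} \<subseteq> up x M (Suc r) 1"
      proof clarify
        fix e assume e: "e \<in> E" "S \<subseteq> e"
        have "card (e - S) = Suc r"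
          using E[OF e(1)] e(2) finS S(2) assms(3) by (simp add: card_Diff_subset)
        moreover have "1 \<le> sum x (e - S)"
          using eT[OF e] \<tau> by (simp add: x_def sum_divide_distrib[symmetric])
        ultimately show "e - S \<in> up x M (Suc r) 1"
          using E[OF e(1)] by (auto simp: up_def M_def)
      qed
      show "finite (up x M (Suc r) 1)" using M by simp
    qed
    moreover have "real (card (up x M (Suc r) 1)) \<le> link_bound (card M) s h r"
    proof (rule card_up_le_link_bound)
      show "sum x M < real s"
      proof -
        have "sum x M = real n / real k"
        proof -
          have "sum x M = sum u M / \<tau>" unfolding x_def by (rule sum_divide_distrib[symmetric])
          moreover have "sum u M = real n / real k * \<tau>" using n(1) k by (simp add: \<tau>_def VM)
          ultimately show ?thesis using \<tau> by simp
        qed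
        also have "\<dots> < real s"
          using assms(6) k by (simp add: pos_divide_less_eq) (metis of_nat_less_iff of_nat_mult)
        finally show ?thesis .
      qed
    qed (use M u0 \<tau> assms(7-9) in \<open>auto simp: x_def\<close>)
    ultimately show ?thesis using M(2) by simp
  qed
  then show ?thesis using S by blast
qed

text \<open>The integer \<open>nat \<lfloor>?B\<rfloor> + 1\<close> exceeds the bound on the degree
  of \<open>S\<close>, so it forces a perfect fractional matching; rounding costs the summand
  1.\<close>

lemma fdeg_le_link_bound:
  assumes "0 < d" "k = d + Suc r" "n < s * k" "d + s \<le> n" "s \<le> h" "h * r \<le> n - d - s"
  shows "real (fdeg d (real n / real k) k n) \<le> link_bound (n - d) s h r + 1"
proof -
  let ?B = "link_bound (n - d) s h r"
  have B: "0 \<le> ?B" by (rule link_bound_nonneg)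
  have "fdeg d (real n / real k) k n \<le> nat \<lfloor>?B\<rfloor> + 1"
    unfolding fdeg_def
  proof (rule Least_le, intro allI impI, rule ccontr)
    fix E assume E: "kgraph k {0..<n} E \<and> min_codeg_ge d {0..<n} E (nat \<lfloor>?B\<rfloor> + 1)"
      and no: "\<not> has_frac_matching_of_size {0..<n} E (real n / real k)"
    obtain S where S: "S \<subseteq> {0..<n}" "card S = d" "real (hdeg E S) \<le> ?B"
      using ex_low_degree_set[of k "{0..<n}" E d r n s h] E no assms by auto
    then have "nat \<lfloor>?B\<rfloor> + 1 \<le> hdeg E S" using E by (auto simp: min_codeg_ge_def)
    then show False using S(3) by linarith
  qed
  then show ?thesis using B by linarith
qed

section \<open>Asymptotics of the bound\<close>

lemma tendsto_choose_over_power: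
  assumes "(\<lambda>n. real (X n) / real n) \<longlonglongrightarrow> c"
  shows "(\<lambda>n. real (X n choose l) / real n ^ l) \<longlonglongrightarrow> c ^ l / fact l"
proof -
  have "real (X n choose l) / real n ^ l = (\<Prod>i = 0..<l. real (X n) / real n - real i / real n) / fact l" for n
    by (simp add: binomial_gbinomial gbinomial_prod_rev prod_dividef diff_divide_distrib[symmetric])
  moreover have "(\<lambda>n. (\<Prod>i = 0..<l. real (X n) / real n - real i / real n) / fact l)
      \<longlonglongrightarrow> (\<Prod>i = 0..<l. c - 0) / fact l"
    by (intro tendsto_intros assms lim_const_over_n) simp
  ultimately show ?thesis by simp
qed

lemma tendsto_div_over_n:
  assumes "(\<lambda>n. real (X n) / real n) \<longlonglongrightarrow> c" "0 < r"
  shows "(\<lambda>n. real (X n div r) / real n) \<longlonglongrightarrow> c / real r"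
proof (rule tendsto_sandwich)
  have "real (X n) / real r - 1 \<le> real (X n div r)" for n
  proof -
    have "real (X n) / real r = real (X n div r) + real (X n mod r) / real r"
      by (rule of_nat_of_nat_div_aux)
    moreover have "real (X n mod r) / real r \<le> 1" using assms(2) by simp
    ultimately show ?thesis by linarith
  qed
  then have "(real (X n) / real r - 1) / real n \<le> real (X n div r) / real n" for n
    by (rule divide_right_mono) simp
  then show "\<forall>\<^sub>F n in sequentially. (real (X n) / real n) / real r - 1 / real n \<le> real (X n div r) / real n"
    by (simp add: diff_divide_distrib mult.commute)
  have "real (X n div r) / real n \<le> (real (X n) / real r) / real n" for n
    by (intro divide_right_mono of_nat_div_le_of_nat) simp
  then show "\<forall>\<^sub>F n in sequentially. real (X n div r) / real n \<le> (real (X n) / real n) / real r"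
    by (simp add: mult.commute)
  show "(\<lambda>n. (real (X n) / real n) / real r) \<longlonglongrightarrow> c / real r"
    using assms by (intro tendsto_intros) auto
  have "(\<lambda>n. (real (X n) / real n) / real r - 1 / real n) \<longlonglongrightarrow> c / real r - 0"
    using assms by (intro tendsto_intros lim_const_over_n) auto
  then show "(\<lambda>n. (real (X n) / real n) / real r - 1 / real n) \<longlonglongrightarrow> c / real r" by simp
qed

text \<open>The right-hand side is the form in which the limit of \<open>link_bound\<close> arises:
  \<open>1 / k\<close>, \<open>q / r\<close> and \<open>q\<close> are the limits of
  \<open>s\<close>, \<open>h\<close> and \<open>n - d - s\<close> over \<open>n\<close>. Since
  \<open>2 * d < k\<close>, the maximum is \<open>(k - 2 * d - 1) / (k * r)\<close>.\<close>

lemma gkd_eq: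
  assumes "k = d + Suc r" "0 < r" "2 * d < k" "q = 1 - 1 / real k"
  shows "gkd k d = 1 - q ^ Suc r + real (Suc r) * (max 0 (2 / real k - q / real r)
    * ((1 / real k) / (q / real r)) * q ^ r)"
proof -
  have k: "real k - 1 > 0" "real k > 0" using assms(1,2) by auto
  have q: "q = (real k - 1) / real k" using k assms(4) by (simp add: field_simps)
  define c where "c = real k - 2 * real d - 1"
  define k1 where "k1 = real k - 1"
  have c: "c = 2 * real r - k1" "0 \<le> c" using assms(1,3) by (auto simp: c_def k1_def)
  have k1: "k1 > 0" "q = k1 / real k" using k q by (auto simp: k1_def)
  have "2 / real k - q / real r = c / (real k * real r)"
    using k(2) assms(2) unfolding c(1) k1(2) by (simp add: field_simps)
  then have "max 0 (2 / real k - q / real r) = c / (real k * real r)"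
    using c(2) by simp
  moreover have "(1 / real k) / (q / real r) = real r / k1"
    using k(2) k1(1) unfolding k1(2) by simp
  moreover have "c / (real k * real r) * (real r / k1) = c / k1\<^sup>2 * q"
    using k(2) k1(1) assms(2) unfolding k1(2) by (simp add: power2_eq_square)
  ultimately have eq: "max 0 (2 / real k - q / real r) * ((1 / real k) / (q / real r)) = c / k1\<^sup>2 * q"
    by (simp only:)
  have "real (Suc r) * (max 0 (2 / real k - q / real r) * ((1 / real k) / (q / real r)) * q ^ r)
      = real (Suc r) * c / k1\<^sup>2 * q ^ Suc r"
    unfolding eq by simp
  moreover have "gkd k d = 1 - (1 - real (Suc r) * c / k1\<^sup>2) * q ^ Suc r"
    using assms(1) by (simp only: gkd_def c_def k1_def assms(4) diff_add_inverse)
  ultimately show ?thesis by (simp only: left_diff_distrib)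
qed

text \<open>Here \<open>s n\<close> is the least integer above \<open>n / k\<close>, and
  \<open>h n\<close> is the largest number of disjoint \<open>r\<close>-sets that fit into the
  remaining \<open>n - d - s n\<close> vertices.\<close>

lemma link_bound_limit:
  assumes "k = d + Suc r" "0 < r" "2 * d < k" "0 < d"
    and "\<And>n. s n = n div k + 1" "\<And>n. h n = (n - d - s n) div r"
  shows "(\<lambda>n. (link_bound (n - d) (s n) (h n) r + 1) / real ((n - d) choose Suc r)) \<longlonglongrightarrow> gkd k d"
    and "\<forall>\<^sub>F n in sequentially. d + s n \<le> n \<and> s n \<le> h n"
proof -
  have k: "0 < k" "1 < real k" using assms(1,2) by auto
  define q where "q = 1 - 1 / real k"
  have q: "q > 0" using k by (simp add: q_def)
  have inv: "(\<lambda>n. c / real n) \<longlonglongrightarrow> 0" for c :: real by (rule lim_const_over_n)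
  have n1: "(\<lambda>n. real n / real n) \<longlonglongrightarrow> 1"
    by (rule tendsto_eventually) (auto intro: eventually_mono[OF eventually_gt_at_top[of 0]])
  have "(\<lambda>n. real (n div k) / real n + 1 / real n) \<longlonglongrightarrow> 1 / real k + 0"
    by (intro tendsto_add tendsto_div_over_n n1 inv k)
  then have S: "(\<lambda>n. real (s n) / real n) \<longlonglongrightarrow> 1 / real k"
    by (simp add: assms(5) add_divide_distrib add.commute)
  have "(\<lambda>n. real d / real n + real (s n) / real n) \<longlonglongrightarrow> 0 + 1 / real k"
    by (intro tendsto_add inv S)
  then have "\<forall>\<^sub>F n in sequentially. real d / real n + real (s n) / real n < 1"
    by (rule order_tendstoD(2)) (use k in auto)
  then have le: "\<forall>\<^sub>F n in sequentially. d + s n \<le> n"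
    using eventually_gt_at_top[of 0]
  proof eventually_elim
    case (elim n)
    then have "real d + real (s n) < real n" by (simp add: field_simps)
    then show ?case by linarith
  qed
  have "(\<lambda>n. real n / real n - real d / real n) \<longlonglongrightarrow> 1 - 0"
    by (intro tendsto_diff n1 inv)
  moreover have "\<forall>\<^sub>F n in sequentially. real n / real n - real d / real n = real (n - d) / real n"
    using le by eventually_elim (simp add: of_nat_diff diff_divide_distrib)
  ultimately have M: "(\<lambda>n. real (n - d) / real n) \<longlonglongrightarrow> 1"
    using Lim_transform_eventually by fastforce
  have "(\<lambda>n. real (n - d) / real n - real (s n) / real n) \<longlonglongrightarrow> q"
    unfolding q_def by (intro tendsto_diff M S)
  moreover have "\<forall>\<^sub>F n in sequentially.
      real (n - d) / real n - real (s n) / real n = real (n - d - s n) / real n"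
    using le by eventually_elim (simp add: diff_divide_distrib[symmetric])
  ultimately have N: "(\<lambda>n. real (n - d - s n) / real n) \<longlonglongrightarrow> q"
    by (rule Lim_transform_eventually)
  have H: "(\<lambda>n. real (h n) / real n) \<longlonglongrightarrow> q / real r"
    unfolding assms(6) by (intro tendsto_div_over_n N assms(2))
  \<comment> \<open>This amounts to \<open>r + 1 < k\<close>, which holds because \<open>d\<close>
    is positive; it makes \<open>s n\<close> eventually at most \<open>h n\<close>.\<close>
  have qr: "1 / real k < q / real r"
  proof -
    have "(real r + 1) / real k < 1" using k assms(1,4) by simp
    then have "1 / real k * real r < q" unfolding q_def by (simp only: add_divide_distrib) simp
    then show ?thesis using assms(2) by (subst pos_less_divide_eq) auto
  qed
  have "(\<lambda>n. real (h n) / real n - real (s n) / real n) \<longlonglongrightarrow> q / real r - 1 / real k"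
    by (intro tendsto_diff H S)
  then have "\<forall>\<^sub>F n in sequentially. 0 < real (h n) / real n - real (s n) / real n"
    by (rule order_tendstoD(1)) (use qr in simp)
  then have "\<forall>\<^sub>F n in sequentially. s n \<le> h n"
    by eventually_elim (simp add: diff_divide_distrib[symmetric] zero_less_divide_iff)
  then show "\<forall>\<^sub>F n in sequentially. d + s n \<le> n \<and> s n \<le> h n"
    by (rule eventually_conj[OF le])
  \<comment> \<open>For positive \<open>n\<close> this is \<open>link_bound\<close> plus 1, divided
    by \<open>n ^ Suc r\<close>, with the powers of \<open>n\<close> distributed so that each factor
    converges. The last summand is the rounding term.\<close>
  define f where "f n = real ((n - d) choose Suc r) / real n ^ Suc r
      - real ((n - d - s n) choose Suc r) / real n ^ Suc r
      + max 0 (2 * (real (s n) / real n) - real (h n) / real n)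
        * (((real (s n) / real n) / (real (h n) / real n)) * (real ((n - d - s n) choose r) / real n ^ r))
      + (1 / real n) ^ Suc r" for n
  have "f \<longlonglongrightarrow> 1 ^ Suc r / fact (Suc r) - q ^ Suc r / fact (Suc r)
      + max 0 (2 * (1 / real k) - q / real r) * (((1 / real k) / (q / real r)) * (q ^ r / fact r))
      + 0 ^ Suc r" (is "_ \<longlonglongrightarrow> ?c")
    unfolding f_def
  proof (intro tendsto_add)
    show "(\<lambda>n. real ((n - d) choose Suc r) / real n ^ Suc r
        - real ((n - d - s n) choose Suc r) / real n ^ Suc r)
        \<longlonglongrightarrow> 1 ^ Suc r / fact (Suc r) - q ^ Suc r / fact (Suc r)"
      by (rule tendsto_diff[OF tendsto_choose_over_power[OF M] tendsto_choose_over_power[OF N]])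
    have "q / real r \<noteq> 0" using q assms(2) by simp
    note ratio = tendsto_divide[OF S H this]
    show "(\<lambda>n. max 0 (2 * (real (s n) / real n) - real (h n) / real n)
        * (((real (s n) / real n) / (real (h n) / real n)) * (real ((n - d - s n) choose r) / real n ^ r)))
        \<longlonglongrightarrow> max 0 (2 * (1 / real k) - q / real r) * (((1 / real k) / (q / real r)) * (q ^ r / fact r))"
      by (rule tendsto_mult[OF tendsto_max[OF tendsto_const tendsto_diff[OF tendsto_mult[OF tendsto_const S] H]]
          tendsto_mult[OF ratio tendsto_choose_over_power[OF N]]])
    show "(\<lambda>n. (1 / real n) ^ Suc r) \<longlonglongrightarrow> 0 ^ Suc r" by (rule tendsto_power[OF inv])
  qed
  then have "(\<lambda>n. f n / (real ((n - d) choose Suc r) / real n ^ Suc r))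
      \<longlonglongrightarrow> ?c / (1 ^ Suc r / fact (Suc r))"
    by (rule tendsto_divide[OF _ tendsto_choose_over_power[OF M]]) auto
  moreover have "?c / (1 ^ Suc r / fact (Suc r)) = gkd k d"
  proof -
    \<comment> \<open>Used with \<open>a * F\<close> equal to the factorial of \<open>Suc r\<close>:
      \<open>F\<close> is the factorial of \<open>r\<close> from the smaller binomial, and the
      quotient \<open>a\<close> is the factor \<open>Suc r\<close> in \<open>gkd_eq\<close>.\<close>
    have scale: "(1 / (a * F) - B / (a * F) + X * (Z * (P / F)) + 0) / (1 / (a * F))
        = 1 - B + a * (X * Z * P)" if "a \<noteq> 0" "F \<noteq> 0" for a F B X Z P :: real
      using that by (simp add: field_simps)
    have "(2::real) * (1 / real k) = 2 / real k" by simp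
    then show ?thesis
      using gkd_eq[OF assms(1-3) q_def] scale[of "real (Suc r)" "fact r"]
      by (simp only: fact_Suc power_one power_0_Suc of_nat_Suc fact_nonzero of_nat_neq_0 simp_thms)
  qed
  moreover have "\<forall>\<^sub>F n in sequentially. f n / (real ((n - d) choose Suc r) / real n ^ Suc r)
      = (link_bound (n - d) (s n) (h n) r + 1) / real ((n - d) choose Suc r)"
    using eventually_gt_at_top[of 0]
  proof eventually_elim
    case (elim n)
    have "max 0 (2 * (real (s n) / real n) - real (h n) / real n)
        = max 0 (2 * real (s n) - real (h n)) / real n"
      using elim by (simp add: max_def field_simps)
    then have "f n = (link_bound (n - d) (s n) (h n) r + 1) / real n ^ Suc r"
      unfolding f_def link_bound_def using elim
      by (simp add: add_divide_distrib diff_divide_distrib power_divide)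
    then show ?case using elim by simp
  qed
  ultimately show "(\<lambda>n. (link_bound (n - d) (s n) (h n) r + 1) / real ((n - d) choose Suc r))
      \<longlonglongrightarrow> gkd k d"
    by (simp only:) (rule Lim_transform_eventually)
qed

theorem theorem1p5:
  fixes k d :: nat
  assumes "k \<ge> 3" and "1 \<le> d" and "2 * d < k"
  shows "\<forall>\<epsilon>>0. \<forall>\<^sub>F n in sequentially.
           real (fdeg d (real n / real k) k n) \<le> (gkd k d + \<epsilon>) * real ((n - d) choose (k - d))"
proof (intro allI impI)
  fix \<epsilon> :: real assume \<epsilon>: "0 < \<epsilon>"
  define r where "r = k - d - 1"
  have r: "k = d + Suc r" "0 < r" "0 < d" using assms by (auto simp: r_def)
  define s where "s n = n div k + 1" for n
  define h where "h n = (n - d - s n) div r" for n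
  note lim = link_bound_limit[OF r(1,2) assms(3) r(3) s_def h_def]
  have "\<forall>\<^sub>F n in sequentially.
      (link_bound (n - d) (s n) (h n) r + 1) / real ((n - d) choose Suc r) < gkd k d + \<epsilon>"
    using lim(1) by (rule order_tendstoD(2)) (use \<epsilon> in simp)
  then show "\<forall>\<^sub>F n in sequentially.
      real (fdeg d (real n / real k) k n) \<le> (gkd k d + \<epsilon>) * real ((n - d) choose (k - d))"
    using lim(2) eventually_ge_at_top[of k]
  proof eventually_elim
    case (elim n)
    have "n < s n * k"
      using assms(1) by (simp add: s_def) (metis add.commute dividend_less_div_times gr0I not_numeral_le_zero)
    moreover have "h n * r \<le> n - d - s n" by (simp add: h_def)
    ultimately have "real (fdeg d (real n / real k) k n) \<le> link_bound (n - d) (s n) (h n) r + 1"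
      using elim(2) by (intro fdeg_le_link_bound[OF r(3,1)]) auto
    also have "\<dots> \<le> (gkd k d + \<epsilon>) * real ((n - d) choose Suc r)"
    proof -
      \<comment> \<open>From \<open>n \<ge> k\<close> on the binomial is positive, so the bound on
        the quotient can be multiplied out.\<close>
      have "Suc r \<le> n - d" using elim(3) r(1) by linarith
      then have "0 < real ((n - d) choose Suc r)" by simp
      then show ?thesis using elim(1) by (simp only: pos_divide_less_eq less_imp_le)
    qed
    also have "Suc r = k - d" using r(1) by linarith
    finally show ?case .
  qed
qed

end
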